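(* Let $F$ be a vector lattice endowed with an idempotent locally solid additive convergence $\eta$. Then the adherence $\overline{H}^{1}_{\eta}$ of every ideal $H\subset F$ is $\eta$-closed, and so is equal to the closure $\overline{H}_{\eta}$.
   Context: Nets are indexed by directed sets. A net $(y_\beta)_{\beta\in B}$ is a quasi-subnet of $(x_\alpha)_{\alpha\in A}$ if for every $\alpha_0\in A$ there is $\beta_0\in B$ with $\{y_\beta:\beta\ge\beta_0\}\subset\{x_\alpha:\alpha\ge\alpha_0\}$. A convergence on a set $X$ is a rule specifying which nets in $X$ converge to which points, such that: constant nets converge to their value; a quasi-subnet of a net converging to $x$ converges to $x$; if $(x_\alpha)_{\alpha\in A}$ and $(y_\alpha)_{\alpha\in A}$ converge to $x$ and $z_\alpha\in\{x_\alpha,y_\alpha\}$ for every $\alpha$, then $(z_\alpha)_{\alpha\in A}$ converges to $x$. Let $F$ be a (real) vector lattice with positive cone $F_+$. A convergence on $F$ is additive if addition and $f\mapsto -f$ are continuous (preserve convergence of nets). An additive convergence is locally solid if $f_\alpha\to 0$ and $|g_\alpha|\le|f_\alpha|$ for all $\alpha$ imply $g_\alpha\to 0$. Such a convergence is determined by its null nets in $F_+$: $f_\alpha\to f$ iff $|f_\alpha-f|\to 0$. Composition: for locally solid additive convergences $\eta,\theta$ on $F$, $\eta\theta$ is the locally solid additive convergence such that a net $(f_\alpha)_{\alpha\in A}\subset F_+$ is $\eta\theta$-null iff there is a $\theta$-null net $(g_\beta)_{\beta\in B}\subset F_+$ with $(f_\alpha-g_\beta)^+\xrightarrow[\alpha]{\eta}0$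 for every $\beta\in B$; in general $f_\alpha\to f$ iff $|f_\alpha-f|\to 0$. A locally solid additive convergence $\eta$ is idempotent if $\eta\eta=\eta$. The adherence $\overline{A}^{1}_{\eta}$ is the set of all $\eta$-limits of nets contained in $A$; $A$ is $\eta$-closed if $\overline{A}^{1}_{\eta}=A$; the closure $\overline{A}_{\eta}$ is the smallest $\eta$-closed set containing $A$. *)

theory Defs
  imports Complex_Main "HOL-Library.Lattice_Algebras"
begin

class vector_lattice = lattice_ab_group_add_abs + ordered_real_vector

definition lattice_ideal :: "'a::vector_lattice set \<Rightarrow> bool" where
  "lattice_ideal H \<longleftrightarrow> subspace H \<and> (\<forall>f g. f \<in> H \<longrightarrow> \<bar>g\<bar> \<le> \<bar>f\<bar> \<longrightarrow> g \<in> H)"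

text \<open>
  A directed set is given by its relation \<open>r\<close>, a nonempty upwards directed preorder on its
  field, where \<open>(i, j) \<in> r\<close> means \<open>i \<le> j\<close>. A net is such an \<open>r\<close> together with a function
  \<open>x\<close>, of which only the values on \<open>Field r\<close> are relevant.
\<close>

definition directed :: "'i rel \<Rightarrow> bool" where
  "directed r \<longleftrightarrow> Field r \<noteq> {} \<and> Preorder r \<and>
     (\<forall>i\<in>Field r. \<forall>j\<in>Field r. \<exists>k. (i, k) \<in> r \<and> (j, k) \<in> r)"

definition quasi_subnet :: "'j rel \<Rightarrow> ('j \<Rightarrow> 'a) \<Rightarrow> 'i rel \<Rightarrow> ('i \<Rightarrow> 'a) \<Rightarrow> bool" where
  "quasi_subnet s y r x \<longleftrightarrow>
     (\<forall>i\<^sub>0\<in>Field r. \<exists>j\<^sub>0\<in>Field s. {y j | j. (j\<^sub>0, j) \<in> s} \<subseteq> {x i | i. (i\<^sub>0, i) \<in> r})"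

text \<open>
  \<open>\<eta> r x l\<close> means that the net \<open>(r, x)\<close> converges to \<open>l\<close>. HOL cannot quantify over all index
  types at once, so the directed sets are those living in an arbitrary type \<open>'i\<close>. By
  \<open>net_equivalent_in_universe\<close> below, no net is lost (up to quasi-subnets in both directions)
  as soon as \<open>'a \<times> 'a set\<close> embeds into \<open>'i\<close>.
\<close>

type_synonym ('i, 'a) conv = "'i rel \<Rightarrow> ('i \<Rightarrow> 'a) \<Rightarrow> 'a \<Rightarrow> bool"

definition convergence :: "('i, 'a) conv \<Rightarrow> bool" where
  "convergence \<eta> \<longleftrightarrow>
     (\<forall>r x l. \<eta> r x l \<longrightarrow> directed r) \<and>
     (\<forall>r l. directed r \<longrightarrow> \<eta> r (\<lambda>_. l) l) \<and>
     (\<forall>r x s y l. \<eta> r x l \<longrightarrow> directed s \<longrightarrow> quasi_subnet s y r x \<longrightarrow> \<eta> s y l) \<and>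
     (\<forall>r x y z l. \<eta> r x l \<longrightarrow> \<eta> r y l \<longrightarrow> (\<forall>i\<in>Field r. z i \<in> {x i, y i}) \<longrightarrow> \<eta> r z l)"

definition additive_convergence :: "('i, 'a::ab_group_add) conv \<Rightarrow> bool" where
  "additive_convergence \<eta> \<longleftrightarrow> convergence \<eta> \<and>
     (\<forall>r x y l m. \<eta> r x l \<longrightarrow> \<eta> r y m \<longrightarrow> \<eta> r (\<lambda>i. x i + y i) (l + m)) \<and>
     (\<forall>r x l. \<eta> r x l \<longrightarrow> \<eta> r (\<lambda>i. - x i) (- l))"

definition locally_solid_additive :: "('i, 'a::vector_lattice) conv \<Rightarrow> bool" where
  "locally_solid_additive \<eta> \<longleftrightarrow> additive_convergence \<eta> \<and>
     (\<forall>r f g. \<eta> r f 0 \<longrightarrow> (\<forall>i\<in>Field r. \<bar>g i\<bar> \<le> \<bar>f i\<bar>) \<longrightarrow> \<eta> r g 0)"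

text \<open>\<open>pprt\<close> is the positive part.\<close>

definition composition_null ::
  "('i, 'a::vector_lattice) conv \<Rightarrow> ('i, 'a) conv \<Rightarrow> 'i rel \<Rightarrow> ('i \<Rightarrow> 'a) \<Rightarrow> bool" where
  "composition_null \<eta> \<theta> r f \<longleftrightarrow> (\<forall>i\<in>Field r. 0 \<le> f i) \<and>
     (\<exists>s g. \<theta> s g 0 \<and> (\<forall>j\<in>Field s. 0 \<le> g j) \<and>
        (\<forall>j\<in>Field s. \<eta> r (\<lambda>i. pprt (f i - g j)) 0))"

definition composition ::
  "('i, 'a::vector_lattice) conv \<Rightarrow> ('i, 'a) conv \<Rightarrow> ('i, 'a) conv" where
  "composition \<eta> \<theta> r f l \<longleftrightarrow> composition_null \<eta> \<theta> r (\<lambda>i. \<bar>f i - l\<bar>)"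

definition idempotent_convergence :: "('i, 'a::vector_lattice) conv \<Rightarrow> bool" where
  "idempotent_convergence \<eta> \<longleftrightarrow> composition \<eta> \<eta> = \<eta>"

definition adherence :: "('i, 'a) conv \<Rightarrow> 'a set \<Rightarrow> 'a set" where
  "adherence \<eta> A = {l. \<exists>r x. (\<forall>i\<in>Field r. x i \<in> A) \<and> \<eta> r x l}"

definition conv_closed :: "('i, 'a) conv \<Rightarrow> 'a set \<Rightarrow> bool" where
  "conv_closed \<eta> A \<longleftrightarrow> adherence \<eta> A = A"

definition conv_closure :: "('i, 'a) conv \<Rightarrow> 'a set \<Rightarrow> 'a set" where
  "conv_closure \<eta> A = conv_closed \<eta> hull A"

lemma directed_singleton: "directed {(i, i)}"
  by (auto simp: directed_def preorder_on_def refl_on_def trans_def Field_def)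

lemma adherenceI: "\<eta> r x l \<Longrightarrow> (\<And>i. i \<in> Field r \<Longrightarrow> x i \<in> A) \<Longrightarrow> l \<in> adherence \<eta> A"
  unfolding adherence_def mem_Collect_eq by (rule exI, rule exI, rule conjI, rule ballI)

lemma subset_adherence:
  assumes "convergence \<eta>"
  shows "A \<subseteq> adherence \<eta> A"
proof
  fix l assume l: "l \<in> A"
  have "\<forall>r l. directed r \<longrightarrow> \<eta> r (\<lambda>_. l) l"
    using assms unfolding convergence_def by (elim conjE)
  then have "\<eta> {(undefined, undefined)} (\<lambda>_. l) l"
    by (simp add: directed_singleton)
  then show "l \<in> adherence \<eta> A"
    using l by (rule adherenceI[where x = "\<lambda>_. l"])
qed

lemma adherence_mono:
  assumes "A \<subseteq> B"
  shows "adherence \<eta> A \<subseteq> adherence \<eta> B"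
proof
  fix l assume "l \<in> adherence \<eta> A"
  then obtain r x where "\<forall>i\<in>Field r. x i \<in> A" "\<eta> r x l"
    unfolding adherence_def mem_Collect_eq by (elim exE conjE)
  then show "l \<in> adherence \<eta> B"
    using assms by (intro adherenceI[of \<eta> r x l B]) auto
qed

lemma conv_closed_Inter:
  assumes "convergence \<eta>" and "\<And>C. C \<in> \<C> \<Longrightarrow> conv_closed \<eta> C"
  shows "conv_closed \<eta> (\<Inter>\<C>)"
proof -
  have "adherence \<eta> (\<Inter>\<C>) \<subseteq> C" if "C \<in> \<C>" for C
    using adherence_mono[of "\<Inter>\<C>" C \<eta>] assms(2)[OF that] that
    unfolding conv_closed_def by blast
  then show ?thesis
    using subset_adherence[OF assms(1), of "\<Inter>\<C>"] unfolding conv_closed_def by blast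
qed

lemma conv_closure_smallest:
  assumes "convergence \<eta>"
  shows "conv_closed \<eta> (conv_closure \<eta> A)" and "A \<subseteq> conv_closure \<eta> A"
    and "\<And>C. conv_closed \<eta> C \<Longrightarrow> A \<subseteq> C \<Longrightarrow> conv_closure \<eta> A \<subseteq> C"
proof -
  show "conv_closed \<eta> (conv_closure \<eta> A)"
    unfolding conv_closure_def by (rule hull_in, rule conv_closed_Inter[OF assms]) blast
  show "A \<subseteq> conv_closure \<eta> A"
    unfolding conv_closure_def by (rule hull_subset)
  show "conv_closure \<eta> A \<subseteq> C" if "conv_closed \<eta> C" "A \<subseteq> C" for C
    unfolding conv_closure_def using that by (intro hull_minimal)
qed

lemma net_equivalent_in_universe:
  fixes r :: "'j rel" and x :: "'j \<Rightarrow> 'a" and \<iota> :: "'a \<times> 'a set \<Rightarrow> 'i"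
  assumes r: "directed r" and \<iota>: "inj \<iota>"
  shows "\<exists>(s :: 'i rel) y. directed s \<and> quasi_subnet s y r x \<and> quasi_subnet r x s y"
proof -
  define T where "T i = {x k | k. (i, k) \<in> r}" for i
  define I where "I = {(p, T i) | p i. i \<in> Field r \<and> p \<in> T i}"
  define s where "s = {(\<iota> u, \<iota> v) | u v. u \<in> I \<and> v \<in> I \<and> snd v \<subseteq> snd u}"
  define y where "y = fst \<circ> inv \<iota>"
  have inv: "inv \<iota> (\<iota> u) = u" for u
    using \<iota> by simp
  have eq: "\<iota> u = \<iota> v \<longleftrightarrow> u = v" for u v
    using \<iota> by (auto dest: injD)
  have s_iff: "(\<iota> u, \<iota> v) \<in> s \<longleftrightarrow> u \<in> I \<and> v \<in> I \<and> snd v \<subseteq> snd u" for u v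
    unfolding s_def by (auto simp only: mem_Collect_eq prod.inject eq)
  have "a \<in> \<iota> ` I \<and> b \<in> \<iota> ` I" if "(a, b) \<in> s" for a b
    using that unfolding s_def by blast
  moreover have "(\<iota> u, \<iota> u) \<in> s" if "u \<in> I" for u
    using that by (simp add: s_iff)
  ultimately have fld: "Field s = \<iota> ` I"
    unfolding Field_def by blast
  have refl: "(i, i) \<in> r" if "i \<in> Field r" for i
    using r that unfolding directed_def preorder_on_def refl_on_def by blast
  have tr: "(i, k) \<in> r" if "(i, j) \<in> r" "(j, k) \<in> r" for i j k
    using r that unfolding directed_def preorder_on_def trans_def by blast
  have Tanti: "T j \<subseteq> T i" if "(i, j) \<in> r" for i j
    using tr[OF that] unfolding T_def by blast
  have xT: "x i \<in> T i" if "i \<in> Field r" for i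
    using refl[OF that] unfolding T_def by blast
  have inI: "(x i, T i) \<in> I" if "i \<in> Field r" for i
    using that xT[OF that] unfolding I_def by blast
  have "directed s"
    unfolding directed_def
  proof (intro conjI ballI)
    show "Field s \<noteq> {}"
      using r inI unfolding fld directed_def by blast
    show "Preorder s"
      unfolding preorder_on_def fld
      by (auto simp: refl_on_def trans_def s_def eq)
    fix a b assume "a \<in> Field s" "b \<in> Field s"
    then obtain p i q j where ij: "i \<in> Field r" "j \<in> Field r"
      and ab: "a = \<iota> (p, T i)" "b = \<iota> (q, T j)" and I: "(p, T i) \<in> I" "(q, T j) \<in> I"
      unfolding fld I_def by blast
    obtain k where k: "(i, k) \<in> r" "(j, k) \<in> r"
      using r ij unfolding directed_def by blast
    then have "k \<in> Field r"
      unfolding Field_def by blast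
    then have "(a, \<iota> (x k, T k)) \<in> s \<and> (b, \<iota> (x k, T k)) \<in> s"
      unfolding ab s_iff using I inI[of k] Tanti[OF k(1)] Tanti[OF k(2)] by auto
    then show "\<exists>c. (a, c) \<in> s \<and> (b, c) \<in> s"
      by blast
  qed
  moreover have tail: "{y c | c. (\<iota> (p, T i), c) \<in> s} = T i"
    if i: "i \<in> Field r" and p: "p \<in> T i" for p i
  proof
    show "{y c | c. (\<iota> (p, T i), c) \<in> s} \<subseteq> T i"
      unfolding s_def by (auto simp: y_def eq inv I_def)
    show "T i \<subseteq> {y c | c. (\<iota> (p, T i), c) \<in> s}"
    proof
      fix q assume "q \<in> T i"
      then have "(\<iota> (p, T i), \<iota> (q, T i)) \<in> s" "y (\<iota> (q, T i)) = q"
        using i p unfolding s_iff by (auto simp: y_def inv I_def)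
      then show "q \<in> {y c | c. (\<iota> (p, T i), c) \<in> s}"
        by force
    qed
  qed
  moreover have "quasi_subnet s y r x"
    unfolding quasi_subnet_def
  proof
    fix i assume i: "i \<in> Field r"
    then have "\<iota> (x i, T i) \<in> Field s"
      using inI[OF i] unfolding fld by blast
    moreover have "{y j | j. (\<iota> (x i, T i), j) \<in> s} \<subseteq> {x k | k. (i, k) \<in> r}"
      unfolding tail[OF i xT[OF i]] unfolding T_def by (rule subset_refl)
    ultimately show "\<exists>c\<in>Field s. {y j | j. (c, j) \<in> s} \<subseteq> {x k | k. (i, k) \<in> r}"
      by (rule bexI[rotated])
  qed
  moreover have "quasi_subnet r x s y"
    unfolding quasi_subnet_def
  proof
    fix c assume "c \<in> Field s"
    then obtain p i where i: "i \<in> Field r" "p \<in> T i" "c = \<iota> (p, T i)"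
      unfolding fld I_def by blast
    have "{x k | k. (i, k) \<in> r} \<subseteq> {y j | j. (c, j) \<in> s}"
      unfolding i(3) tail[OF i(1,2)] unfolding T_def by (rule subset_refl)
    then show "\<exists>i\<in>Field r. {x k | k. (i, k) \<in> r} \<subseteq> {y j | j. (c, j) \<in> s}"
      using i(1) by (rule bexI)
  qed
  ultimately show ?thesis
    by (intro exI conjI)
qed

end

(*
  For an ideal H and u >= 0 the set D(u) of all h in H with 0 <= h <= u, ordered by <=, is an
  increasing net. By idempotence it converges to u as soon as some net (x_i) in [0, u] converges
  to u and (x_i - d)^+ -> 0 along d in D(u) for every i. If all x_i are in H, then
  (x_i - d)^+ is eventually 0; hence the net D(u) converges to u for every u >= 0 in the
  adherence of H. If the x_i are only in the adherence of H, then (x_i - d)^+ = x_i - inf x_i d,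
  and inf x_i d is a quasi-subnet of D(x_i), which converges to x_i; so the criterion applies
  once more. A general f in the iterated adherence is the limit of its truncations to [-d, d]
  with d in D(|f|).
*)

theory Submission
  imports Defs
begin

section \<open>Positive parts and truncations in a vector lattice\<close>

lemma pprt_diff_eq: "pprt (a - b) = a - inf a (b::'a::lattice_ab_group_add)"
proof -
  have "a - inf a b = a + sup (- a) (- b)"
    by (simp add: neg_inf_eq_sup)
  also have "\<dots> = sup 0 (a - b)"
    by (simp add: add_sup_distrib_left)
  finally show ?thesis
    by (simp add: pprt_def sup_commute)
qed

lemma pprt_diff_le_abs:
  fixes a b u :: "'a::lattice_ab_group_add_abs"
  assumes "u \<le> \<bar>a\<bar>"
  shows "pprt (u - \<bar>b\<bar>) \<le> \<bar>b - a\<bar>"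
proof -
  have "u - \<bar>b\<bar> \<le> \<bar>a\<bar> - \<bar>b\<bar>"
    using assms by (rule diff_right_mono)
  also have "\<dots> \<le> \<bar>a - b\<bar>"
    by (rule abs_triangle_ineq2)
  also have "\<dots> = \<bar>b - a\<bar>"
    by (rule abs_minus_commute)
  finally show ?thesis
    unfolding pprt_def by (rule le_supI) simp
qed

text \<open>\<open>sup (inf f d) (- d)\<close> is the truncation of \<open>f\<close> to the interval
  from \<open>- d\<close> to \<open>d\<close>; by this bound it lies in every ideal that contains
  \<open>d\<close>.\<close>

lemma abs_clamp_le:
  fixes d f :: "'a::lattice_ab_group_add_abs"
  assumes "0 \<le> d"
  shows "\<bar>sup (inf f d) (- d)\<bar> \<le> d"
proof (rule abs_leI)
  have "- d \<le> d"
    using assms by (metis neg_le_0_iff_le order_trans)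
  then show "sup (inf f d) (- d) \<le> d"
    by simp
  have "- d \<le> sup (inf f d) (- d)"
    by simp
  then show "- sup (inf f d) (- d) \<le> d"
    by (simp add: minus_le_iff)
qed

text \<open>Turns convergence to \<open>|f|\<close> of elements \<open>d \<le> |f|\<close> into
  convergence to \<open>f\<close> of the truncations of \<open>f\<close> at
  \<open>d\<close>.\<close>

lemma abs_clamp_diff_le:
  fixes d f :: "'a::lattice_ab_group_add_abs"
  assumes "d \<le> \<bar>f\<bar>"
  shows "\<bar>sup (inf f d) (- d) - f\<bar> \<le> \<bar>f\<bar> - d"
proof (rule abs_leI)
  have f: "f \<le> \<bar>f\<bar>" "- f \<le> \<bar>f\<bar>"
    by (auto simp: abs_ge_self abs_ge_minus_self)
  have "inf f d \<le> \<bar>f\<bar> - d + f"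
    using assms by (intro order_trans[OF inf_le1]) simp
  moreover have "- d \<le> \<bar>f\<bar> - d + f"
    using add_right_mono[OF f(2), of "f - d"] by (simp add: algebra_simps)
  ultimately show "sup (inf f d) (- d) - f \<le> \<bar>f\<bar> - d"
    by (simp add: diff_le_eq)
  have "pprt (f - d) \<le> \<bar>f\<bar> - d"
    unfolding pprt_def using f(1) assms by (intro le_supI) (simp_all add: diff_right_mono)
  then have "f - inf f d \<le> \<bar>f\<bar> - d"
    by (simp add: pprt_diff_eq)
  then have "f - sup (inf f d) (- d) \<le> \<bar>f\<bar> - d"
    by (rule order_trans[rotated]) (simp add: diff_left_mono)
  then show "- (sup (inf f d) (- d) - f) \<le> \<bar>f\<bar> - d"
    by simp
qed

section \<open>Convergences and local solidity\<close>

lemma convergence_directed: "convergence \<eta> \<Longrightarrow> \<eta> r x l \<Longrightarrow> directed r"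
  unfolding convergence_def by metis

lemma convergence_const: "convergence \<eta> \<Longrightarrow> directed r \<Longrightarrow> \<eta> r (\<lambda>_. l) l"
  unfolding convergence_def by metis

lemma convergence_quasi_subnet:
  "convergence \<eta> \<Longrightarrow> \<eta> r x l \<Longrightarrow> directed s \<Longrightarrow> quasi_subnet s y r x \<Longrightarrow> \<eta> s y l"
  unfolding convergence_def by (elim conjE) metis

text \<open>A tail only meets indices in \<open>Field r\<close>, so each tail of \<open>y\<close> is
  a tail of \<open>x\<close>, and \<open>y\<close> is a quasi-subnet of \<open>x\<close>.\<close>

lemma convergence_cong:
  assumes "convergence \<eta>" "\<eta> r x l" "\<And>i. i \<in> Field r \<Longrightarrow> y i = x i"
  shows "\<eta> r y l"
proof (rule convergence_quasi_subnet[OF assms(1), OF assms(2) convergence_directed[OF assms(1), OF assms(2)]])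
  have "{y j | j. (i, j) \<in> r} \<subseteq> {x j | j. (i, j) \<in> r}" for i
    using assms(3) FieldI2[of i _ r] by fastforce
  then show "quasi_subnet r y r x"
    unfolding quasi_subnet_def by (intro ballI bexI)
qed

context
  fixes \<eta> :: "('i, 'a::vector_lattice) conv"
  assumes lsa: "locally_solid_additive \<eta>"
begin

lemma lsa_convergence: "convergence \<eta>"
  using lsa unfolding locally_solid_additive_def additive_convergence_def by blast

lemma lsa_diff_null_iff: "\<eta> r (\<lambda>i. x i - l) 0 \<longleftrightarrow> \<eta> r x l"
proof -
  have "\<forall>r x y l m. \<eta> r x l \<longrightarrow> \<eta> r y m \<longrightarrow> \<eta> r (\<lambda>i. x i + y i) (l + m)"
    using lsa unfolding locally_solid_additive_def additive_convergence_def by (elim conjE)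
  note sum = this[rule_format]
  have add: "\<eta> r (\<lambda>i. x i + c) (l + c)" if "\<eta> r x l" for x c l
    using convergence_directed[OF lsa_convergence, OF that]
    by (intro sum[of r x l "\<lambda>_. c" c] that convergence_const[OF lsa_convergence])
  show ?thesis
    using add[of x l "- l"] add[of "\<lambda>i. x i - l" 0 l] by auto
qed

text \<open>Local solidity compares null nets only; subtracting the limits, which may differ,
  reduces to that case.\<close>

lemma lsa_dominated:
  assumes "\<eta> r x l" "\<And>i. i \<in> Field r \<Longrightarrow> \<bar>y i - m\<bar> \<le> \<bar>x i - l\<bar>"
  shows "\<eta> r y m"
proof -
  have "\<forall>r f g. \<eta> r f 0 \<longrightarrow> (\<forall>i\<in>Field r. \<bar>g i\<bar> \<le> \<bar>f i\<bar>) \<longrightarrow> \<eta> r g 0"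
    using lsa unfolding locally_solid_additive_def by (elim conjE)
  note null_solid = this[rule_format]
  have "\<eta> r (\<lambda>i. x i - l) 0"
    using assms(1) by (simp add: lsa_diff_null_iff)
  then have "\<eta> r (\<lambda>i. y i - m) 0"
    using null_solid[of r "\<lambda>i. x i - l" "\<lambda>i. y i - m"] assms(2) by simp
  then show ?thesis
    by (simp add: lsa_diff_null_iff)
qed

text \<open>The distance from \<open>inf u |x i|\<close> to \<open>u\<close> is the positive part of
  \<open>u - |x i|\<close>, which the triangle inequality bounds by \<open>|x i - a|\<close>. For
  \<open>0 \<le> u\<close> these truncations stay in any ideal that contains the
  \<open>x i\<close>.\<close>

lemma lsa_truncate:
  assumes "\<eta> r x a" "u \<le> \<bar>a\<bar>"
  shows "\<eta> r (\<lambda>i. inf u \<bar>x i\<bar>) u"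
proof (rule lsa_dominated[OF assms(1)])
  fix i
  have "\<bar>(inf u \<bar>x i\<bar>) - u\<bar> = \<bar>pprt (u - \<bar>x i\<bar>)\<bar>"
    unfolding pprt_diff_eq by (rule abs_minus_commute)
  then show "\<bar>(inf u \<bar>x i\<bar>) - u\<bar> \<le> \<bar>x i - a\<bar>"
    using pprt_diff_le_abs[OF assms(2)] by simp
qed

end

section \<open>Ideals and increasing nets indexed by their own elements\<close>

lemma lattice_idealD:
  "lattice_ideal H \<Longrightarrow> f \<in> H \<Longrightarrow> \<bar>g\<bar> \<le> \<bar>f\<bar> \<Longrightarrow> g \<in> H"
  unfolding lattice_ideal_def by blast

definition below_in :: "'a::vector_lattice set \<Rightarrow> 'a \<Rightarrow> 'a set" where
  "below_in H u = {h \<in> H. 0 \<le> h \<and> h \<le> u}"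

text \<open>Ideals are defined by linearity and solidity, so suprema are reached through
  \<open>0 \<le> sup d e \<le> d + e\<close>, valid for positive \<open>d\<close> and
  \<open>e\<close>.\<close>

lemma sup_in_below_in:
  assumes "lattice_ideal H" "d \<in> below_in H u" "e \<in> below_in H u"
  shows "sup d e \<in> below_in H u"
proof -
  have de: "d \<in> H" "e \<in> H" "0 \<le> d" "0 \<le> e" "d \<le> u" "e \<le> u"
    using assms(2,3) by (auto simp: below_in_def)
  have "d + e \<in> H"
    using assms(1) de unfolding lattice_ideal_def by (blast intro: subspace_add)
  moreover have "0 \<le> sup d e"
    using de(3) by (rule le_supI1)
  moreover have "sup d e \<le> d + e"
    using de by (simp add: add_increasing add_increasing2)
  ultimately have "sup d e \<in> H"
    using de lattice_idealD[OF assms(1), of "d + e" "sup d e"] by simp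
  then show ?thesis
    using de \<open>0 \<le> sup d e\<close> by (simp add: below_in_def)
qed

text \<open>\<open>D\<close> as a net indexed by itself; \<open>\<kappa>\<close> only moves the indices into the index type.\<close>

definition order_net :: "('a::order \<Rightarrow> 'i) \<Rightarrow> 'a set \<Rightarrow> 'i rel" where
  "order_net \<kappa> D = {(\<kappa> d, \<kappa> e) | d e. d \<in> D \<and> e \<in> D \<and> d \<le> e}"

lemma Field_order_net: "Field (order_net \<kappa> D) = \<kappa> ` D"
  unfolding order_net_def Field_def by blast

lemma order_net_iff:
  "inj \<kappa> \<Longrightarrow> (\<kappa> d, k) \<in> order_net \<kappa> D \<longleftrightarrow> (\<exists>e. k = \<kappa> e \<and> d \<in> D \<and> e \<in> D \<and> d \<le> e)"
  unfolding order_net_def by (auto dest: injD)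

lemma directed_order_net:
  assumes "inj \<kappa>" "D \<noteq> {}"
    and "\<And>d e. d \<in> D \<Longrightarrow> e \<in> D \<Longrightarrow> \<exists>c\<in>D. d \<le> c \<and> e \<le> c"
  shows "directed (order_net \<kappa> D)"
  unfolding directed_def Field_order_net
proof (intro conjI ballI)
  show "\<kappa> ` D \<noteq> {}"
    using assms(2) by simp
  show "preorder_on (\<kappa> ` D) (order_net \<kappa> D)"
    unfolding preorder_on_def
    unfolding refl_on_def trans_def
    by (force simp: order_net_iff[OF assms(1)] order_net_def inj_eq[OF assms(1)])
  fix i j assume "i \<in> \<kappa> ` D" "j \<in> \<kappa> ` D"
  then show "\<exists>k. (i, k) \<in> order_net \<kappa> D \<and> (j, k) \<in> order_net \<kappa> D"
    using assms(3) by (force simp: order_net_iff[OF assms(1)])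
qed

text \<open>Expresses the inclusion of tails through elements of \<open>D\<close> instead of their
  indices: past some \<open>d\<close>, each value of \<open>y\<close> is one that \<open>x\<close>
  takes beyond \<open>i\<close>.\<close>

lemma quasi_subnet_order_net:
  assumes "inj \<kappa>"
    and "\<And>i. i \<in> Field r \<Longrightarrow> \<exists>d\<in>D. \<forall>e\<in>D. d \<le> e \<longrightarrow> (\<exists>j. (i, j) \<in> r \<and> y (\<kappa> e) = x j)"
  shows "quasi_subnet (order_net \<kappa> D) y r x"
  unfolding quasi_subnet_def Field_order_net
proof
  fix i assume "i \<in> Field r"
  then obtain d where d: "d \<in> D" "\<forall>e\<in>D. d \<le> e \<longrightarrow> (\<exists>j. (i, j) \<in> r \<and> y (\<kappa> e) = x j)"
    using assms(2) by blast
  then have "{y j | j. (\<kappa> d, j) \<in> order_net \<kappa> D} \<subseteq> {x j | j. (i, j) \<in> r}"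
    by (auto simp: order_net_iff[OF assms(1)])
  then show "\<exists>k\<in>\<kappa> ` D. {y j | j. (k, j) \<in> order_net \<kappa> D} \<subseteq> {x j | j. (i, j) \<in> r}"
    using d(1) by blast
qed

section \<open>Adherences of an ideal under idempotence\<close>

context
  fixes \<eta> :: "('i, 'a::vector_lattice) conv" and \<kappa> :: "'a \<Rightarrow> 'i" and H :: "'a set"
  assumes lsa: "locally_solid_additive \<eta>"
    and idem: "idempotent_convergence \<eta>"
    and \<kappa>: "inj \<kappa>"
    and H: "lattice_ideal H"
begin

lemma directed_below_in:
  assumes "0 \<le> u"
  shows "directed (order_net \<kappa> (below_in H u))"
proof (rule directed_order_net[OF \<kappa>])
  have "0 \<in> H"
    using H unfolding lattice_ideal_def by (blast intro: subspace_0)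
  then show "below_in H u \<noteq> {}"
    using assms by (auto simp: below_in_def)
  fix d e assume "d \<in> below_in H u" "e \<in> below_in H u"
  then show "\<exists>c\<in>below_in H u. d \<le> c \<and> e \<le> c"
    using sup_in_below_in[OF H] by (intro bexI[of _ "sup d e"]) simp_all
qed

text \<open>This is where idempotence enters. The inner net of the composition is
  \<open>u - x i\<close>, which is null and positive. For \<open>d \<le> u\<close> one has
  \<open>|d - u| - (u - x i) = x i - d\<close>, so \<open>null\<close> is exactly the outer
  condition.\<close>

lemma below_in_tendsto:
  assumes x: "\<eta> r x u" "\<And>i. i \<in> Field r \<Longrightarrow> 0 \<le> x i \<and> x i \<le> u"
    and null: "\<And>i. i \<in> Field r \<Longrightarrow>
      \<eta> (order_net \<kappa> (below_in H u)) (\<lambda>k. pprt (x i - inv \<kappa> k)) 0"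
  shows "\<eta> (order_net \<kappa> (below_in H u)) (inv \<kappa>) u"
proof -
  let ?N = "order_net \<kappa> (below_in H u)"
  have conv: "convergence \<eta>"
    using lsa by (rule lsa_convergence)
  have "\<eta> r (\<lambda>i. u - x i) 0"
    using lsa_dominated[OF lsa, OF x(1), of "\<lambda>i. u - x i" 0] by (simp add: abs_minus_commute)
  moreover have "\<eta> ?N (\<lambda>k. pprt (\<bar>inv \<kappa> k - u\<bar> - (u - x i))) 0" if "i \<in> Field r" for i
  proof (rule convergence_cong[OF conv, OF null[OF that]])
    fix k assume "k \<in> Field ?N"
    then have "inv \<kappa> k \<le> u"
      using \<kappa> by (auto simp: Field_order_net below_in_def)
    then have "\<bar>inv \<kappa> k - u\<bar> = u - inv \<kappa> k"
      by (subst abs_minus_commute) simp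
    then show "pprt (\<bar>inv \<kappa> k - u\<bar> - (u - x i)) = pprt (x i - inv \<kappa> k)"
      by simp
  qed
  ultimately have "composition \<eta> \<eta> ?N (inv \<kappa>) u"
    using x(2) unfolding composition_def composition_null_def by force
  then show ?thesis
    using idem by (simp add: idempotent_convergence_def)
qed

lemma below_in_tendsto_if_adherence:
  assumes "0 \<le> u" "u \<in> adherence \<eta> H"
  shows "\<eta> (order_net \<kappa> (below_in H u)) (inv \<kappa>) u"
proof -
  let ?D = "below_in H u"
  have conv: "convergence \<eta>"
    using lsa by (rule lsa_convergence)
  obtain r x where x: "\<forall>i\<in>Field r. x i \<in> H" "\<eta> r x u"
    using assms(2) unfolding adherence_def mem_Collect_eq by (elim exE conjE)
  let ?x = "\<lambda>i. inf u \<bar>x i\<bar>"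
  have D: "?x i \<in> ?D" if "i \<in> Field r" for i
    using x(1) that assms(1) lattice_idealD[OF H, of "x i" "?x i"] by (simp add: below_in_def)
  have "\<eta> (order_net \<kappa> ?D) (\<lambda>k. pprt (?x i - inv \<kappa> k)) 0" if i: "i \<in> Field r" for i
  proof (rule convergence_quasi_subnet[OF conv, OF _ directed_below_in[OF assms(1)]])
    \<comment> \<open>The constant zero net over \<open>r\<close> serves as comparison: all its
      tails are \<open>{0}\<close>, and the positive parts vanish once the index is above
      \<open>?x i\<close>, which itself belongs to \<open>?D\<close>.\<close>
    show "\<eta> r (\<lambda>_. 0) 0"
      by (rule convergence_const[OF conv, OF convergence_directed[OF conv, OF x(2)]])
    show "quasi_subnet (order_net \<kappa> ?D) (\<lambda>k. pprt (?x i - inv \<kappa> k)) r (\<lambda>_. 0)"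
    proof (rule quasi_subnet_order_net[OF \<kappa>])
      fix j assume "j \<in> Field r"
      then have "(j, j) \<in> r"
        using convergence_directed[OF conv, OF x(2)]
        unfolding directed_def preorder_on_def refl_on_def by blast
      then show "\<exists>d\<in>?D. \<forall>e\<in>?D. d \<le> e \<longrightarrow> (\<exists>k. (j, k) \<in> r \<and> pprt (?x i - inv \<kappa> (\<kappa> e)) = 0)"
        using \<kappa> by (intro bexI[OF _ D[OF i]]) auto
    qed
  qed
  moreover have "\<eta> r ?x u"
    by (rule lsa_truncate[OF lsa, OF x(2)]) (simp add: abs_ge_self)
  ultimately show ?thesis
    using D by (intro below_in_tendsto[of r ?x]) (auto simp: below_in_def)
qed

text \<open>Truncating at \<open>u\<close> a net in \<open>H\<close> with limit \<open>a\<close>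
  gives a net with limit \<open>u\<close>, still in \<open>H\<close> because its members are
  dominated by those of the first net.\<close>

lemma adherence_solid:
  assumes "a \<in> adherence \<eta> H" "0 \<le> u" "u \<le> \<bar>a\<bar>"
  shows "u \<in> adherence \<eta> H"
proof -
  obtain r x where x: "\<forall>i\<in>Field r. x i \<in> H" "\<eta> r x a"
    using assms(1) unfolding adherence_def mem_Collect_eq by (elim exE conjE)
  show ?thesis
  proof (rule adherenceI[of \<eta>, OF lsa_truncate[OF lsa, OF x(2) assms(3)]])
    fix i assume "i \<in> Field r"
    then show "inf u \<bar>x i\<bar> \<in> H"
      using x(1) assms(2) lattice_idealD[OF H, of "x i" "inf u \<bar>x i\<bar>"] by simp
  qed
qed

lemma below_in_tendsto_if_adherence_adherence:
  assumes "f \<in> adherence \<eta> (adherence \<eta> H)"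
  shows "\<eta> (order_net \<kappa> (below_in H \<bar>f\<bar>)) (inv \<kappa>) \<bar>f\<bar>"
proof -
  let ?D = "below_in H \<bar>f\<bar>"
  have conv: "convergence \<eta>"
    using lsa by (rule lsa_convergence)
  obtain r x where x: "\<forall>i\<in>Field r. x i \<in> adherence \<eta> H" "\<eta> r x f"
    using assms unfolding adherence_def[of \<eta> "adherence \<eta> H"] mem_Collect_eq by (elim exE conjE)
  \<comment> \<open>Truncation puts the net below \<open>|f|\<close>, as the criterion demands, and
    \<open>adherence_solid\<close> keeps its members in the adherence, so that each of them is the
    limit of the elements of \<open>H\<close> below it.\<close>
  let ?x = "\<lambda>i. inf (\<bar>f\<bar>) (\<bar>x i\<bar>)"
  have "\<eta> (order_net \<kappa> ?D) (\<lambda>k. pprt (?x i - inv \<kappa> k)) 0" if i: "i \<in> Field r" for i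
  proof -
    let ?E = "below_in H (?x i)"
    have "?x i \<in> adherence \<eta> H"
      by (rule adherence_solid[of "x i"]) (use x(1) i in auto)
    then have "\<eta> (order_net \<kappa> ?E) (inv \<kappa>) (?x i)"
      by (intro below_in_tendsto_if_adherence) simp_all
    from lsa_dominated[OF lsa, OF this, of "\<lambda>k. ?x i - inv \<kappa> k" 0]
    have lim: "\<eta> (order_net \<kappa> ?E) (\<lambda>k. ?x i - inv \<kappa> k) 0"
      by (simp add: abs_minus_commute)
    have dir: "directed (order_net \<kappa> ?D)"
      by (rule directed_below_in) simp
    \<comment> \<open>The map sending \<open>e\<close> to \<open>inf (?x i) e\<close> takes
      \<open>?D\<close> into \<open>?E\<close>. Since \<open>?x i \<le> |f|\<close>, an element
      \<open>d\<close> of \<open>?E\<close> is also in \<open>?D\<close>, and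
      \<open>d \<le> e\<close> implies \<open>d \<le> inf (?x i) e\<close>. The values agree by
      \<open>pprt_diff_eq\<close>.\<close>
    have "quasi_subnet (order_net \<kappa> ?D) (\<lambda>k. pprt (?x i - inv \<kappa> k))
        (order_net \<kappa> ?E) (\<lambda>k. ?x i - inv \<kappa> k)"
    proof (rule quasi_subnet_order_net[OF \<kappa>])
      fix k assume "k \<in> Field (order_net \<kappa> ?E)"
      then obtain d where d: "d \<in> ?E" "k = \<kappa> d"
        by (auto simp: Field_order_net)
      have "(k, \<kappa> (inf (?x i) e)) \<in> order_net \<kappa> ?E" if e: "e \<in> ?D" "d \<le> e" for e
      proof -
        have "0 \<le> e" "e \<in> H"
          using e(1) by (auto simp: below_in_def)
        then have "inf (?x i) e \<in> ?E"
          using lattice_idealD[OF H, of e "inf (?x i) e"] by (simp add: below_in_def le_infI1)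
        moreover have "d \<le> inf (?x i) e"
          using d(1) e(2) by (simp add: below_in_def)
        ultimately show ?thesis
          unfolding d(2) order_net_iff[OF \<kappa>] using d(1) by blast
      qed
      moreover have "d \<in> ?D"
        using d(1) by (simp add: below_in_def)
      ultimately show "\<exists>d\<in>?D. \<forall>e\<in>?D. d \<le> e \<longrightarrow> (\<exists>j. (k, j) \<in> order_net \<kappa> ?E \<and>
          pprt (?x i - inv \<kappa> (\<kappa> e)) = ?x i - inv \<kappa> j)"
        using \<kappa> by (metis inv_f_f pprt_diff_eq)
    qed
    then show ?thesis
      by (rule convergence_quasi_subnet[OF conv, OF lim dir])
  qed
  moreover have "\<eta> r ?x \<bar>f\<bar>"
    by (rule lsa_truncate[OF lsa, OF x(2)]) simp
  ultimately show ?thesis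
    by (intro below_in_tendsto[of r ?x]) auto
qed

lemma adherence_adherence: "adherence \<eta> (adherence \<eta> H) \<subseteq> adherence \<eta> H"
proof
  fix f assume "f \<in> adherence \<eta> (adherence \<eta> H)"
  then have lim: "\<eta> (order_net \<kappa> (below_in H \<bar>f\<bar>)) (inv \<kappa>) \<bar>f\<bar>"
    by (rule below_in_tendsto_if_adherence_adherence)
  \<comment> \<open>The limit \<open>|f|\<close> carries no sign; truncating \<open>f\<close> at the
    elements of the net restores it and stays in \<open>H\<close>.\<close>
  let ?y = "\<lambda>k. sup (inf f (inv \<kappa> k)) (- inv \<kappa> k)"
  have D: "inv \<kappa> k \<in> below_in H \<bar>f\<bar>" if "k \<in> Field (order_net \<kappa> (below_in H \<bar>f\<bar>))" for k
    using that \<kappa> by (auto simp: Field_order_net)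
  have "\<eta> (order_net \<kappa> (below_in H \<bar>f\<bar>)) ?y f"
  proof (rule lsa_dominated[OF lsa, OF lim])
    fix k assume "k \<in> Field (order_net \<kappa> (below_in H \<bar>f\<bar>))"
    then have "inv \<kappa> k \<le> \<bar>f\<bar>"
      using D by (simp add: below_in_def)
    then have "\<bar>?y k - f\<bar> \<le> \<bar>f\<bar> - inv \<kappa> k"
      by (rule abs_clamp_diff_le)
    also have "\<dots> \<le> \<bar>\<bar>f\<bar> - inv \<kappa> k\<bar>"
      by (rule abs_ge_self)
    finally show "\<bar>?y k - f\<bar> \<le> \<bar>inv \<kappa> k - \<bar>f\<bar>\<bar>"
      by (simp only: abs_minus_commute)
  qed
  moreover have "?y k \<in> H" if "k \<in> Field (order_net \<kappa> (below_in H \<bar>f\<bar>))" for k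
    using D[OF that] abs_clamp_le[of "inv \<kappa> k" f] lattice_idealD[OF H, of "inv \<kappa> k" "?y k"]
    by (simp add: below_in_def)
  ultimately show "f \<in> adherence \<eta> H"
    by (rule adherenceI[of \<eta> _ ?y f])
qed

end

theorem mainTheorem3:
  fixes \<eta> :: "('i, 'a::vector_lattice) conv"
    and \<iota> :: "'a \<times> 'a set \<Rightarrow> 'i"
    and H :: "'a set"
  assumes "inj \<iota>"
    and "locally_solid_additive \<eta>"
    and "idempotent_convergence \<eta>"
    and "lattice_ideal H"
  shows "conv_closed \<eta> (adherence \<eta> H) \<and> adherence \<eta> H = conv_closure \<eta> H"
proof
  have conv: "convergence \<eta>"
    using assms(2) by (rule lsa_convergence)
  \<comment> \<open>Pairing with a fixed set embeds \<open>'a\<close> itself into the index type,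
    which suffices to index the order nets.\<close>
  have "inj (\<lambda>a. \<iota> (a, {}))"
    using assms(1) by (auto intro: injI dest: injD)
  then have "adherence \<eta> (adherence \<eta> H) \<subseteq> adherence \<eta> H"
    by (rule adherence_adherence[OF assms(2,3) _ assms(4)])
  then show closed: "conv_closed \<eta> (adherence \<eta> H)"
    using subset_adherence[OF conv] unfolding conv_closed_def by blast
  \<comment> \<open>The closure is closed and contains \<open>H\<close>, so by monotonicity it
    contains the adherence of \<open>H\<close>.\<close>
  have "adherence \<eta> H \<subseteq> conv_closure \<eta> H"
    using adherence_mono[OF conv_closure_smallest(2)[OF conv]] conv_closure_smallest(1)[OF conv]
    unfolding conv_closed_def by blast
  then show "adherence \<eta> H = conv_closure \<eta> H"
    using conv_closure_smallest(3)[OF conv closed subset_adherence[OF conv]] by blast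
qed

end
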